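(* Let $Y$ be a Bernoulli random variable with probability of success $p$ (so $P(Y=1)=p$, $P(Y=0)=1-p$). Then for every integer $n\ge 1$ and every real $x$, $$B_{n}^{(L,Y)}(x)=B_{n}^{L}(px).$$ In addition, for all integers $n,k$ with $n\ge 1$ and $n\ge k\ge 0$, $$L_{Y}(n,k)=p^{k}L(n,k).$$
   Context: Rising factorial: $\langle x\rangle_0=1$, $\langle x\rangle_n=x(x+1)\cdots(x+n-1)$ for $n\ge 1$. Falling factorial: $(x)_0=1$, $(x)_n=x(x-1)\cdots(x-n+1)$ for $n\ge 1$. The unsigned Lah numbers $L(n,k)$ ($n\ge k\ge 0$) are defined by $\langle x\rangle_{n}=\sum_{k=0}^{n}L(n,k)(x)_{k}$. The Lah-Bell polynomials are $B_{n}^{L}(x)=\sum_{l=0}^{n}L(n,l)x^{l}$, $n\ge 0$. For a random variable $Y$ whose moment generating function exists in a neighborhood of $0$, the probabilistic Lah numbers $L_Y(n,k)$ ($n\ge k\ge 0$) are defined by the power series expansion about $t=0$ $$\frac{1}{k!}\left(E\left[\left(\frac{1}{1-t}\right)^{Y}\right]-1\right)^{k}=\sum_{n=k}^{\infty}L_{Y}(n,k)\frac{t^{n}}{n!},\quad k\ge 0,$$ and the probabilistic Lah-Bell polynomials associated with $Y$ are $B_{n}^{(L,Y)}(x)=\sum_{k=0}^{n}L_{Y}(n,k)x^{k}$, $n\ge 0$. *)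

theory Defs
  imports "HOL-Probability.Probability"
begin

text \<open>The rising factorial is \<^const>\<open>pochhammer\<close>.\<close>

definition ffact :: "real \<Rightarrow> nat \<Rightarrow> real" where
  "ffact x n = (\<Prod>i<n. x - real i)"

definition lah_expansion :: "nat \<Rightarrow> (nat \<Rightarrow> real) \<Rightarrow> bool" where
  "lah_expansion n c \<longleftrightarrow>
     (\<forall>x::real. pochhammer x n = (\<Sum>k\<le>n. c k * ffact x k)) \<and> (\<forall>k>n. c k = 0)"

definition lah :: "nat \<Rightarrow> nat \<Rightarrow> real" where
  "lah n = (THE c. lah_expansion n c)"

definition lah_bell :: "nat \<Rightarrow> real \<Rightarrow> real" where
  "lah_bell n x = (\<Sum>l\<le>n. lah n l * x ^ l)"

definition prob_lah_expansion :: "'a measure \<Rightarrow> ('a \<Rightarrow> real) \<Rightarrow> nat \<Rightarrow> (nat \<Rightarrow> real) \<Rightarrow> bool" where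
  "prob_lah_expansion M Y k c \<longleftrightarrow>
     (\<forall>\<^sub>F t in nhds (0::real).
        (\<lambda>n. c n * (t ^ n / fact n)) sums
          (1 / fact k * ((LINT \<omega>|M. (1 / (1 - t)) powr Y \<omega>) - 1) ^ k)) \<and>
     (\<forall>n<k. c n = 0)"

definition prob_lah :: "'a measure \<Rightarrow> ('a \<Rightarrow> real) \<Rightarrow> nat \<Rightarrow> nat \<Rightarrow> real" where
  "prob_lah M Y n k = (THE c. prob_lah_expansion M Y k c) n"

definition prob_lah_bell :: "'a measure \<Rightarrow> ('a \<Rightarrow> real) \<Rightarrow> nat \<Rightarrow> real \<Rightarrow> real" where
  "prob_lah_bell M Y n x = (\<Sum>k\<le>n. prob_lah M Y n k * x ^ k)"


text \<open>The coefficients in both expansions are determined uniquely, and the first expansion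
  always exists, so the definite descriptions above denote what they should.\<close>

lemma ffact_Suc: "ffact x (Suc k) = (x - real k) * ffact x k"
  by (simp add: ffact_def mult.commute)

lemma ffact_of_nat_eq_0: "m < k \<Longrightarrow> ffact (real m) k = 0"
  unfolding ffact_def by (rule prod_zero) auto

lemma ffact_of_nat_neq_0: "ffact (real m) m \<noteq> 0"
  by (auto simp: ffact_def)

lemma lah_expansion_exists: "\<exists>c. lah_expansion n c"
proof (induction n)
  case 0
  show ?case
    by (rule exI[of _ "\<lambda>k. if k = 0 then 1 else 0"]) (simp add: lah_expansion_def ffact_def)
next
  case (Suc n)
  then obtain c where c: "\<And>x::real. pochhammer x n = (\<Sum>k\<le>n. c k * ffact x k)"
    and z: "\<And>k. k > n \<Longrightarrow> c k = 0"
    by (auto simp: lah_expansion_def)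
  define d where "d k = (real n + real k) * c k + (if k = 0 then 0 else c (k - 1))" for k
  have "pochhammer x (Suc n) = (\<Sum>k\<le>Suc n. d k * ffact x k)" for x :: real
  proof -
    have "pochhammer x (Suc n) = (\<Sum>k\<le>n. c k * ffact x k * (x + real n))"
      by (simp add: pochhammer_Suc c sum_distrib_right)
    also have "\<dots> = (\<Sum>k\<le>n. (real n + real k) * c k * ffact x k + c k * ffact x (Suc k))"
      by (intro sum.cong) (auto simp: ffact_Suc algebra_simps)
    also have "\<dots> = (\<Sum>k\<le>Suc n. (real n + real k) * c k * ffact x k)
                     + (\<Sum>k\<le>n. c k * ffact x (Suc k))"
      by (simp add: sum.distrib z)
    also have "(\<Sum>k\<le>n. c k * ffact x (Suc k)) =
               (\<Sum>k\<le>Suc n. (if k = 0 then 0 else c (k - 1)) * ffact x k)"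
      by (subst sum.atMost_Suc_shift) simp
    also have "(\<Sum>k\<le>Suc n. (real n + real k) * c k * ffact x k) + \<dots> =
               (\<Sum>k\<le>Suc n. d k * ffact x k)"
      unfolding d_def by (simp only: sum.distrib [symmetric] distrib_right)
    finally show ?thesis .
  qed
  moreover have "d k = 0" if "k > Suc n" for k
    using that by (simp add: d_def z)
  ultimately show ?case
    unfolding lah_expansion_def by blast
qed

lemma lah_expansion_unique:
  assumes "lah_expansion n c" "lah_expansion n d"
  shows "c = d"
proof
  fix m
  show "c m = d m"
  proof (induction m rule: less_induct)
    case (less m)
    show ?case
    proof (cases "m \<le> n")
      case True
      have "(\<Sum>k\<le>n. c k * ffact (real m) k) = (\<Sum>k\<le>n. d k * ffact (real m) k)"
        using assms unfolding lah_expansion_def by metis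
      then have "(\<Sum>k\<le>n. (c k - d k) * ffact (real m) k) = 0"
        by (simp add: left_diff_distrib sum_subtractf)
      also have "(\<Sum>k\<le>n. (c k - d k) * ffact (real m) k) =
                 (\<Sum>k\<in>{m}. (c k - d k) * ffact (real m) k)"
      proof (rule sum.mono_neutral_right)
        show "\<forall>k\<in>{..n} - {m}. (c k - d k) * ffact (real m) k = 0"
        proof
          fix k assume "k \<in> {..n} - {m}"
          then have "k < m \<or> m < k" by auto
          then show "(c k - d k) * ffact (real m) k = 0"
            using less ffact_of_nat_eq_0 by auto
        qed
      qed (use True in auto)
      finally show ?thesis by (simp add: ffact_of_nat_neq_0)
    next
      case False
      then show ?thesis using assms by (simp add: lah_expansion_def)
    qed
  qed
qed

lemma lah_expansion_lah: "lah_expansion n (lah n)"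
proof -
  obtain c where c: "lah_expansion n c"
    using lah_expansion_exists by blast
  then have "lah n = c"
    unfolding lah_def
    by (rule the_equality[where P = "lah_expansion n"]) (rule lah_expansion_unique[OF _ c])
  with c show ?thesis by simp
qed

lemma prob_lah_expansion_unique:
  assumes "prob_lah_expansion M Y k c" "prob_lah_expansion M Y k d"
  shows "c = d"
proof
  define a where "a n = (c n - d n) / fact n" for n
  have "\<forall>\<^sub>F t in nhds (0::real). (\<lambda>n. a n * t ^ n) sums 0"
    using assms[unfolded prob_lah_expansion_def, THEN conjunct1]
  proof eventually_elim
    case (elim t)
    from sums_diff[OF elim] show ?case
      by (simp add: a_def algebra_simps diff_divide_distrib)
  qed
  then obtain e where e: "e > 0" "\<And>t. \<bar>t\<bar> < e \<Longrightarrow> (\<lambda>n. a n * t ^ n) sums 0"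
    by (auto simp: eventually_nhds_metric dist_real_def)
  fix n
  have "a n = 0"
  proof (induction n rule: less_induct)
    case (less n)
    have "(\<lambda>i. a (i + n) * t ^ i) sums 0" if "t \<noteq> 0" "norm t < e" for t :: real
    proof -
      have "(\<lambda>i. a (i + n) * t ^ (i + n)) sums (0 - (\<Sum>i<n. a i * t ^ i))"
        using e(2)[of t] that by (intro sums_split_initial_segment) auto
      then have "(\<lambda>i. a (i + n) * t ^ (i + n)) sums 0"
        using less by simp
      then have "(\<lambda>i. a (i + n) * t ^ (i + n) / t ^ n) sums (0 / t ^ n)"
        by (rule sums_divide)
      with that show ?thesis by (simp add: power_add)
    qed
    then have "((\<lambda>t::real. 0::real) \<longlongrightarrow> a (0 + n)) (at 0)"
      by (intro powser_limit_0_strong[OF e(1), where a = "\<lambda>i. a (i + n)"]) auto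
    then show ?case
      using LIM_unique[OF _ tendsto_const] by (metis add_0)
  qed
  then show "c n = d n" by (simp add: a_def)
qed

lemma prob_lah_eqI:
  assumes "prob_lah_expansion M Y k c"
  shows "prob_lah M Y n k = c n"
proof -
  have "(THE c. prob_lah_expansion M Y k c) = c"
    using assms
    by (rule the_equality[where P = "prob_lah_expansion M Y k"]) (rule prob_lah_expansion_unique[OF _ assms])
  then show ?thesis by (simp add: prob_lah_def)
qed

end

theory Submission
  imports Defs
begin

text \<open>Up to the factor \<open>n! / k!\<close>, the Lah number \<open>L(n,k)\<close> is the generalised binomial coefficient
  of \<open>n - 1\<close> over \<open>n - k\<close>: this is the Chu--Vandermonde convolution applied to
  \<open>\<langle>x\<rangle>\<^sub>n / n!\<close>, which is \<open>x + (n - 1)\<close> over \<open>n\<close>. The same coefficients appear in Newton's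
  expansion of \<open>t\<^sup>k (1 - t)\<^sup>-\<^sup>k\<close>. For Bernoulli \<open>Y\<close> the generating function
  \<open>E[(1 - t)\<^sup>-\<^sup>Y] - 1\<close> equals \<open>p t / (1 - t)\<close>, so its \<open>k\<close>-th power is \<open>p\<^sup>k\<close> times
  \<open>(t / (1 - t))\<^sup>k\<close>.\<close>

lemma ffact_eq_gbinomial: "ffact x k = fact k * (x gchoose k)"
  by (simp add: ffact_def gbinomial_prod_rev atLeast0LessThan)

text \<open>The value \<open>real n - 1\<close> is \<open>-1\<close> at \<open>n = 0\<close>; with a generalised binomial
  coefficient the formula remains correct there.\<close>

lemma lah_eq:
  "lah n k = (if k \<le> n then fact n / fact k * ((real n - 1) gchoose (n - k)) else 0)"
proof -
  define c where
    "c k = (if k \<le> n then fact n / fact k * ((real n - 1) gchoose (n - k)) else 0)" for k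
  have "pochhammer x n = (\<Sum>k\<le>n. c k * ffact x k)" for x :: real
  proof -
    have "(\<Sum>k\<le>n. c k * ffact x k) =
        fact n * (\<Sum>k\<le>n. (x gchoose k) * ((real n - 1) gchoose (n - k)))"
      unfolding sum_distrib_left by (rule sum.cong) (auto simp: c_def ffact_eq_gbinomial)
    also have "\<dots> = fact n * ((x + (real n - 1)) gchoose n)"
      by (simp only: gbinomial_Vandermonde flip: atLeast0AtMost)
    also have "\<dots> = pochhammer x n"
      by (simp add: gbinomial_pochhammer' algebra_simps)
    finally show ?thesis ..
  qed
  then have "lah_expansion n c"
    by (simp add: lah_expansion_def c_def)
  then have "lah n = c"
    using lah_expansion_lah lah_expansion_unique by blast
  then show ?thesis
    by (simp add: c_def)
qed

lemma lah_generating_function: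
  fixes t :: real
  assumes "\<bar>t\<bar> < 1"
  shows "(\<lambda>n. lah n k * (t ^ n / fact n)) sums (1 / fact k * (t / (1 - t)) ^ k)"
proof -
  have "(\<lambda>m. ((- real k) gchoose m) * (- t) ^ m) sums (1 + - t) powr (- real k)"
    using assms by (intro gen_binomial_real) simp
  moreover have "((- real k) gchoose m) * (- t) ^ m = ((real (m + k) - 1) gchoose m) * t ^ m" for m
  proof -
    \<comment> \<open>Upper negation of the binomial coefficient yields one sign
      \<open>(-1) ^ m\<close>, the power of \<open>- t\<close> another; they cancel.\<close>
    have "((- real k) gchoose m) * (- t) ^ m =
        ((-1) ^ m * (-1) ^ m) * (((real (m + k) - 1) gchoose m) * t ^ m)"
      unfolding gbinomial_minus power_minus[of t] by (simp add: add.commute)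
    then show ?thesis
      by (simp flip: power_mult_distrib)
  qed
  moreover have "(1 + - t) powr (- real k) = 1 / (1 - t) ^ k"
    using assms by (simp add: powr_minus powr_realpow divide_inverse)
  ultimately have "(\<lambda>m. ((real (m + k) - 1) gchoose m) * t ^ m) sums (1 / (1 - t) ^ k)"
    by simp
  then have "(\<lambda>m. t ^ k / fact k * (((real (m + k) - 1) gchoose m) * t ^ m)) sums
      (t ^ k / fact k * (1 / (1 - t) ^ k))"
    by (rule sums_mult)
  moreover have "t ^ k / fact k * (((real (m + k) - 1) gchoose m) * t ^ m) =
      lah (m + k) k * (t ^ (m + k) / fact (m + k))" for m
    by (simp add: lah_eq power_add)
  ultimately have "(\<lambda>m. lah (m + k) k * (t ^ (m + k) / fact (m + k))) sums
      (1 / fact k * (t / (1 - t)) ^ k)"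
    by (simp add: power_divide)
  \<comment> \<open>The terms cut off by the index shift vanish, since \<open>lah n k = 0\<close>
    for \<open>n < k\<close>.\<close>
  moreover have "(\<Sum>n<k. lah n k * (t ^ n / fact n)) = 0"
    by (simp add: lah_eq)
  ultimately show ?thesis
    using sums_iff_shift[of "\<lambda>n. lah n k * (t ^ n / fact n)" k] by simp
qed

text \<open>The two level sets are disjoint and their masses add up to 1, so no mass is left for
  other values.\<close>

lemma (in prob_space) AE_bernoulli:
  fixes Y :: "'a \<Rightarrow> real"
  assumes [measurable]: "Y \<in> borel_measurable M"
    and "prob {\<omega> \<in> space M. Y \<omega> = 1} = p"
    and "prob {\<omega> \<in> space M. Y \<omega> = 0} = 1 - p"
  shows "AE \<omega> in M. Y \<omega> = 0 \<or> Y \<omega> = 1"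
proof -
  have "prob ({\<omega> \<in> space M. Y \<omega> = 1} \<union> {\<omega> \<in> space M. Y \<omega> = 0}) = p + (1 - p)"
    using assms(2,3) by (subst finite_measure_Union) auto
  also have "{\<omega> \<in> space M. Y \<omega> = 1} \<union> {\<omega> \<in> space M. Y \<omega> = 0} =
      {\<omega> \<in> space M. Y \<omega> = 0 \<or> Y \<omega> = 1}"
    by auto
  finally show ?thesis
    by (subst prob_Collect_eq_1[symmetric]) simp_all
qed

text \<open>Almost everywhere \<open>a powr Y\<close> is affine in the indicator of
  \<open>Y = 1\<close>, whose expectation is \<open>p\<close>; \<open>a > 0\<close> gives
  \<open>a powr 0 = 1\<close> and \<open>a powr 1 = a\<close>.\<close>

lemma (in prob_space) expectation_powr_bernoulli:
  fixes Y :: "'a \<Rightarrow> real"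
  assumes [measurable]: "Y \<in> borel_measurable M"
    and "prob {\<omega> \<in> space M. Y \<omega> = 1} = p"
    and "prob {\<omega> \<in> space M. Y \<omega> = 0} = 1 - p"
    and "a > 0"
  shows "expectation (\<lambda>\<omega>. a powr Y \<omega>) = 1 + p * (a - 1)"
proof -
  let ?A = "{\<omega> \<in> space M. Y \<omega> = 1}"
  have "expectation (\<lambda>\<omega>. a powr Y \<omega>) = expectation (\<lambda>\<omega>. 1 + indicator ?A \<omega> * (a - 1))"
  proof (rule integral_cong_AE)
    show "AE \<omega> in M. a powr Y \<omega> = 1 + indicator ?A \<omega> * (a - 1)"
      using AE_bernoulli[OF assms(1-3)] AE_space
      by eventually_elim (use \<open>a > 0\<close> in \<open>auto simp: indicator_def\<close>)
  qed measurable
  also have "\<dots> = 1 + p * (a - 1)"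
    using assms(2) by (subst Bochner_Integration.integral_add)
      (auto simp: prob_space less_top[symmetric])
  finally show ?thesis .
qed

lemma (in prob_space) prob_lah_bernoulli:
  fixes Y :: "'a \<Rightarrow> real"
  assumes "Y \<in> borel_measurable M"
    and "prob {\<omega> \<in> space M. Y \<omega> = 1} = p"
    and "prob {\<omega> \<in> space M. Y \<omega> = 0} = 1 - p"
  shows "prob_lah M Y n k = p ^ k * lah n k"
proof (rule prob_lah_eqI)
  \<comment> \<open>On this interval the base \<open>1 / (1 - t)\<close> is positive and the Lah
    series converges.\<close>
  have "\<forall>\<^sub>F t in nhds (0::real). t \<in> {-1<..<1}"
    by (rule eventually_nhds_in_open) auto
  then have "\<forall>\<^sub>F t in nhds (0::real). (\<lambda>n. p ^ k * lah n k * (t ^ n / fact n)) sums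
      (1 / fact k * (expectation (\<lambda>\<omega>. (1 / (1 - t)) powr Y \<omega>) - 1) ^ k)"
  proof eventually_elim
    case (elim t)
    then have "expectation (\<lambda>\<omega>. (1 / (1 - t)) powr Y \<omega>) - 1 = p * (1 / (1 - t) - 1)"
      using expectation_powr_bernoulli[OF assms, of "1 / (1 - t)"] by simp
    also have "1 / (1 - t) - 1 = t / (1 - t)"
      using elim by (simp add: field_simps)
    finally show ?case
      using sums_mult[OF lah_generating_function[of t k], of "p ^ k"] elim
      by (simp add: power_mult_distrib power_divide mult_ac abs_less_iff)
  qed
  then show "prob_lah_expansion M Y k (\<lambda>n. p ^ k * lah n k)"
    by (simp add: prob_lah_expansion_def lah_eq)
qed

theorem theorem2p14:
  fixes M :: "'a measure" and Y :: "'a \<Rightarrow> real" and p :: real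
  assumes "prob_space M"
    and "Y \<in> borel_measurable M"
    and "measure M {\<omega> \<in> space M. Y \<omega> = 1} = p"
    and "measure M {\<omega> \<in> space M. Y \<omega> = 0} = 1 - p"
  shows "(\<forall>n\<ge>1. \<forall>x::real. prob_lah_bell M Y n x = lah_bell n (p * x)) \<and>
         (\<forall>n k. n \<ge> 1 \<and> k \<le> n \<longrightarrow> prob_lah M Y n k = p ^ k * lah n k)"
  \<comment> \<open>In each term of the polynomial, \<open>p ^ k\<close> merges with
    \<open>x ^ k\<close> into \<open>(p * x) ^ k\<close>.\<close>
  using prob_space.prob_lah_bernoulli[OF assms]
  by (simp add: prob_lah_bell_def lah_bell_def power_mult_distrib mult_ac)

end
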